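(* Let $(A,\mu)$ be an associative and commutative algebra over $\mathbf{k}$, let $\alpha \colon A \to A$ be an algebra morphism, and let $D \colon A \to A$ be a derivation such that $D\alpha = \alpha D$. Define $$x \ast y = \alpha(xD(y)) \qquad (x,y \in A).$$ Then $(A,\ast,\alpha)$ is a Hom-Novikov algebra.
   Context: Throughout, $\mathbf{k}$ is a ground field of characteristic $0$; vector spaces and (bi)linear maps are over $\mathbf{k}$. Given a bilinear multiplication $\mu \colon A^{\otimes 2} \to A$, write $xy$ for $\mu(x,y)$. Algebras are not assumed unital. An algebra morphism $f \colon A \to A$ on $(A,\mu)$ is a linear map with $f \circ \mu = \mu \circ f^{\otimes 2}$, i.e. $f(xy) = f(x)f(y)$ for all $x,y \in A$. A derivation on $(A,\mu)$ is a linear map $D \colon A \to A$ with $D(xy) = D(x)y + xD(y)$ for all $x,y\in A$. A Hom-Novikov algebra is a triple $(A,\mu,\alpha)$ where $A$ is a vector space, $\mu \colon A^{\otimes 2} \to A$ is a bilinear map (written $xy=\mu(x,y)$) and $\alpha \colon A \to A$ is a linear map, such that for all $x,y,z \in A$: (i) $\alpha(xy) = \alpha(x)\alpha(y)$; (ii) $(xy)\alpha(z) - \alpha(x)(yz) = (yx)\alpha(z) - \alpha(y)(xz)$; (iii) $(xy)\alpha(z) = (xz)\alpha(y)$. *)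

theory Defs
  imports Complex_Main
begin

text \<open>
  A vector space is a type \<open>'a\<close> of class \<open>ab_group_add\<close> with a scalar multiplication \<open>scale\<close>
  satisfying the locale \<open>vector_space\<close>. The qualified name \<open>Vector_Spaces.linear\<close> is
  needed because plain \<open>linear\<close> denotes the special case of real scalars; it includes
  \<open>vector_space scale\<close>. Multiplications are explicit binary functions on \<open>'a\<close>, so no unit is
  assumed and one space can carry several of them.
\<close>

definition bilinear_mult ::
  "('k::field \<Rightarrow> 'a::ab_group_add \<Rightarrow> 'a) \<Rightarrow> ('a \<Rightarrow> 'a \<Rightarrow> 'a) \<Rightarrow> bool" where
  "bilinear_mult scale \<mu> \<longleftrightarrow>
     (\<forall>x. Vector_Spaces.linear scale scale (\<lambda>y. \<mu> x y)) \<and>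
     (\<forall>y. Vector_Spaces.linear scale scale (\<lambda>x. \<mu> x y))"

definition assoc_comm_algebra ::
  "('k::field \<Rightarrow> 'a::ab_group_add \<Rightarrow> 'a) \<Rightarrow> ('a \<Rightarrow> 'a \<Rightarrow> 'a) \<Rightarrow> bool" where
  "assoc_comm_algebra scale \<mu> \<longleftrightarrow>
     vector_space scale \<and> bilinear_mult scale \<mu> \<and>
     (\<forall>x y z. \<mu> (\<mu> x y) z = \<mu> x (\<mu> y z)) \<and>
     (\<forall>x y. \<mu> x y = \<mu> y x)"

definition algebra_morphism ::
  "('k::field \<Rightarrow> 'a::ab_group_add \<Rightarrow> 'a) \<Rightarrow> ('a \<Rightarrow> 'a \<Rightarrow> 'a) \<Rightarrow> ('a \<Rightarrow> 'a) \<Rightarrow> bool" where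
  "algebra_morphism scale \<mu> f \<longleftrightarrow>
     Vector_Spaces.linear scale scale f \<and> (\<forall>x y. f (\<mu> x y) = \<mu> (f x) (f y))"

definition derivation ::
  "('k::field \<Rightarrow> 'a::ab_group_add \<Rightarrow> 'a) \<Rightarrow> ('a \<Rightarrow> 'a \<Rightarrow> 'a) \<Rightarrow> ('a \<Rightarrow> 'a) \<Rightarrow> bool" where
  "derivation scale \<mu> D \<longleftrightarrow>
     Vector_Spaces.linear scale scale D \<and> (\<forall>x y. D (\<mu> x y) = \<mu> (D x) y + \<mu> x (D y))"

definition hom_novikov_algebra ::
  "('k::field \<Rightarrow> 'a::ab_group_add \<Rightarrow> 'a) \<Rightarrow> ('a \<Rightarrow> 'a \<Rightarrow> 'a) \<Rightarrow> ('a \<Rightarrow> 'a) \<Rightarrow> bool" where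
  "hom_novikov_algebra scale \<mu> \<alpha> \<longleftrightarrow>
     vector_space scale \<and> bilinear_mult scale \<mu> \<and> Vector_Spaces.linear scale scale \<alpha> \<and>
     (\<forall>x y. \<alpha> (\<mu> x y) = \<mu> (\<alpha> x) (\<alpha> y)) \<and>
     (\<forall>x y z. \<mu> (\<mu> x y) (\<alpha> z) - \<mu> (\<alpha> x) (\<mu> y z) = \<mu> (\<mu> y x) (\<alpha> z) - \<mu> (\<alpha> y) (\<mu> x z)) \<and>
     (\<forall>x y z. \<mu> (\<mu> x y) (\<alpha> z) = \<mu> (\<mu> x z) (\<alpha> y))"

end

theory Submission
  imports Defs
begin

text \<open>
  Since \<open>\<alpha>\<close> is multiplicative and commutes with \<open>D\<close>, both sides of each axiom are images under
  \<open>\<alpha>\<^sup>2\<close>: \<open>(x \<ast> y) \<ast> \<alpha> z = \<alpha>\<^sup>2 (x D(y) D(z))\<close>, which is symmetric in \<open>y, z\<close>, and by the Leibniz rule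
  \<open>(x \<ast> y) \<ast> \<alpha> z - \<alpha> x \<ast> (y \<ast> z) = - \<alpha>\<^sup>2 (x y D(D(z)))\<close>, which is symmetric in \<open>x, y\<close>.
\<close>

theorem corollary1p3:
  fixes scale :: "'k::field_char_0 \<Rightarrow> 'a::ab_group_add \<Rightarrow> 'a"
    and \<mu> :: "'a \<Rightarrow> 'a \<Rightarrow> 'a"
    and \<alpha> D :: "'a \<Rightarrow> 'a"
  assumes "assoc_comm_algebra scale \<mu>"
    and "algebra_morphism scale \<mu> \<alpha>"
    and "derivation scale \<mu> D"
    and "D \<circ> \<alpha> = \<alpha> \<circ> D"
  shows "hom_novikov_algebra scale (\<lambda>x y. \<alpha> (\<mu> x (D y))) \<alpha>"
proof -
  have vs: "vector_space scale"
    and lin_right: "\<And>x. Vector_Spaces.linear scale scale (\<mu> x)"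
    and lin_left: "\<And>y. Vector_Spaces.linear scale scale (\<lambda>x. \<mu> x y)"
    and assoc: "\<And>x y z. \<mu> (\<mu> x y) z = \<mu> x (\<mu> y z)"
    and comm: "\<And>x y. \<mu> x y = \<mu> y x"
    using assms(1) unfolding assoc_comm_algebra_def bilinear_mult_def by blast+
  have lin_\<alpha>: "Vector_Spaces.linear scale scale \<alpha>"
    and \<alpha>_mult: "\<And>x y. \<alpha> (\<mu> x y) = \<mu> (\<alpha> x) (\<alpha> y)"
    using assms(2) unfolding algebra_morphism_def by blast+
  have lin_D: "Vector_Spaces.linear scale scale D"
    and leibniz: "\<And>x y. D (\<mu> x y) = \<mu> (D x) y + \<mu> x (D y)"
    using assms(3) unfolding derivation_def by blast+
  have D_\<alpha>: "D (\<alpha> x) = \<alpha> (D x)" for x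
    using assms(4) by (rule comp_eq_dest)
  have left_comm: "\<mu> x (\<mu> y z) = \<mu> y (\<mu> x z)" for x y z
    by (metis assoc comm)
  have \<mu>_add: "\<mu> x (y + z) = \<mu> x y + \<mu> x z" for x y z
    using lin_right by (simp add: Vector_Spaces.linear_iff)
  have \<alpha>_add: "\<alpha> (x + y) = \<alpha> x + \<alpha> y" for x y
    using lin_\<alpha> by (simp add: Vector_Spaces.linear_iff)
  \<comment> \<open>For fixed \<open>x\<close> the map is \<alpha> after \<open>\<mu> x\<close>
    after \<open>D\<close>; for fixed \<open>y\<close> it is \<alpha> after right multiplication by
    the constant \<open>D y\<close>.\<close>
  have bilinear: "bilinear_mult scale (\<lambda>x y. \<alpha> (\<mu> x (D y)))"
    using Vector_Spaces.linear_compose[OF Vector_Spaces.linear_compose[OF lin_D lin_right] lin_\<alpha>]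
      Vector_Spaces.linear_compose[OF lin_left lin_\<alpha>]
    by (simp add: bilinear_mult_def comp_def)
  have right_nested: "\<alpha> (\<mu> (\<alpha> x) (D (\<alpha> (\<mu> y (D z)))))
      = \<alpha> (\<alpha> (\<mu> x (\<mu> (D y) (D z)))) + \<alpha> (\<alpha> (\<mu> x (\<mu> y (D (D z)))))" for x y z
    \<comment> \<open>Flipping \<open>\<alpha>_mult\<close> gathers every \<alpha> on the outside,
      so that only \<open>D\<close> of a product in \<open>A\<close> needs expanding.\<close>
    by (simp add: D_\<alpha> leibniz \<mu>_add \<alpha>_add flip: \<alpha>_mult)
  have left_nested: "\<alpha> (\<mu> (\<alpha> (\<mu> x (D y))) (D (\<alpha> z))) = \<alpha> (\<alpha> (\<mu> x (\<mu> (D y) (D z))))" for x y z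
    by (simp add: D_\<alpha> assoc flip: \<alpha>_mult)
  have "\<alpha> (\<alpha> (\<mu> x (D y))) = \<alpha> (\<mu> (\<alpha> x) (D (\<alpha> y)))" for x y
    by (simp add: D_\<alpha> \<alpha>_mult)
  moreover have "\<alpha> (\<mu> (\<alpha> (\<mu> x (D y))) (D (\<alpha> z))) - \<alpha> (\<mu> (\<alpha> x) (D (\<alpha> (\<mu> y (D z)))))
      = \<alpha> (\<mu> (\<alpha> (\<mu> y (D x))) (D (\<alpha> z))) - \<alpha> (\<mu> (\<alpha> y) (D (\<alpha> (\<mu> x (D z)))))" for x y z
    \<comment> \<open>The first summand of \<open>right_nested\<close> cancels against
      \<open>left_nested\<close>; the instance at \<open>x y\<close> makes \<open>left_comm\<close>
      a one-way rewrite that matches the remaining terms.\<close>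
    by (simp add: left_nested right_nested left_comm[of x y])
  moreover have "\<alpha> (\<mu> (\<alpha> (\<mu> x (D y))) (D (\<alpha> z))) = \<alpha> (\<mu> (\<alpha> (\<mu> x (D z))) (D (\<alpha> y)))" for x y z
    \<comment> \<open>Fixing \<open>D y\<close> as the first factor makes \<open>comm\<close> swap
      the factors on the left-hand side only.\<close>
    by (simp add: left_nested comm[of "D y"])
  ultimately show ?thesis
    unfolding hom_novikov_algebra_def using vs bilinear lin_\<alpha> by blast
qed

end
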